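(* Let $Q=(q(i,j))_{i,j\in\mathbb{Z}_+}$ be an ergodic generator with stationary distribution vector $\pi=(\pi(i))_{i\in\mathbb{Z}_+}$. Let $B\subset\mathbb{Z}_+$ be a finite nonempty set and $B^*=\max B$. For each $n\ge B^*$ let $$B_n^+=\Big\{\nu\in\{0,1,\dots,n\}:\ \sum_{j\in B}\big[(-{}_{[n]}Q)^{-1}\big]_{\nu,j}>0\Big\},$$ and let ${}_{[n]}\alpha_{B}=({}_{[n]}\alpha_{B}(i))_{0\le i\le n}$ be any probability vector such that $\sum_{i\in B_n^+}{}_{[n]}\alpha_B(i)>0$. Let $\pi_B=(\pi(i))_{i\in B}$ and $\pi_B^*=\pi_B/(\pi_Be)$. Then $$\lim_{n\to\infty}\frac{{}_{[n]}\alpha_B(-{}_{[n]}Q)^{-1}{}_{[n]}E_B}{{}_{[n]}\alpha_B(-{}_{[n]}Q)^{-1}{}_{[n]}E_B\,e}=\pi_B^* .$$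
   Context: $\mathbb{Z}_+=\{0,1,2,\dots\}$. An ergodic generator is the infinitesimal generator ($Q$-matrix) $Q=(q(i,j))_{i,j\in\mathbb{Z}_+}$ of an ergodic (irreducible and positive recurrent, hence non-explosive) continuous-time Markov chain on $\mathbb{Z}_+$; thus $\sum_{j}q(i,j)=0$, $q(i,i)\in(-\infty,0)$ and $q(i,j)\ge 0$ for $j\ne i$. Its stationary distribution vector $\pi$ is the unique positive row vector with $\pi Q=0$ and $\pi e=1$, where $e$ is a column vector of ones of appropriate order. ${}_{[n]}Q=(q(i,j))_{0\le i,j\le n}$ is the $(n+1)\times(n+1)$ northwest-corner truncation of $Q$; it is nonsingular and $(-{}_{[n]}Q)^{-1}\ge O$. For $B\subseteq\{0,\dots,n\}$, ${}_{[n]}E_B$ is the $(n+1)\times|B|$ matrix with rows indexed by $\{0,\dots,n\}$ and columns indexed by $B$ whose $(i,j)$ entry is $1$ if $i=j$ and $0$ otherwise, so that right multiplication by ${}_{[n]}E_B$ selects the columns in $B$. *)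

theory Defs
  imports
    "HOL-Probability.Probability"
    "Jordan_Normal_Form.Gauss_Jordan_Elimination"
begin

section \<open>Ergodic generators on the nonnegative integers\<close>

definition conservative_q_matrix :: "(nat \<Rightarrow> nat \<Rightarrow> real) \<Rightarrow> bool" where
  "conservative_q_matrix q \<longleftrightarrow>
     (\<forall>i. q i i < 0) \<and> (\<forall>i j. i \<noteq> j \<longrightarrow> 0 \<le> q i j) \<and> (\<forall>i. (\<lambda>j. q i j) sums 0)"

definition jump_prob :: "(nat \<Rightarrow> nat \<Rightarrow> real) \<Rightarrow> nat \<Rightarrow> nat \<Rightarrow> real" where
  "jump_prob q i j = (if i = j then 0 else q i j / (- q i i))"

text \<open>
  A path records the successive states of the jump chain together with the holding times:
  at step k the chain sits in state \<open>fst (w k)\<close> for the duration \<open>snd (w k)\<close>.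
\<close>

type_synonym path = "nat \<Rightarrow> nat \<times> real"

definition path_space :: "path measure" where
  "path_space = (\<Pi>\<^sub>M k\<in>UNIV. count_space UNIV \<Otimes>\<^sub>M borel)"

text \<open>
  The law of the chain with generator \<open>q\<close> started in \<open>x\<close>: the jump chain is the discrete-time
  Markov chain with transition matrix \<open>jump_prob q\<close>, and given the jump chain, the holding times
  are independent, the one spent in state \<open>i\<close> being exponential with parameter \<open>- q i i\<close>.
  The events below form an intersection-stable generator of the path space (up to null sets),
  so they determine the law.
\<close>

definition ctmc_law :: "(nat \<Rightarrow> nat \<Rightarrow> real) \<Rightarrow> nat \<Rightarrow> path measure \<Rightarrow> bool" where
  "ctmc_law q x M \<longleftrightarrow>
     prob_space M \<and> sets M = sets path_space \<and>
     (\<forall>n (y :: nat \<Rightarrow> nat) (t :: nat \<Rightarrow> real). (\<forall>k\<le>n. 0 \<le> t k) \<longrightarrow>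
        measure M {w \<in> space M. \<forall>k\<le>n. fst (w k) = y k \<and> t k < snd (w k)} =
          (if y 0 = x then 1 else 0) * (\<Prod>k<n. jump_prob q (y k) (y (Suc k)))
            * (\<Prod>k\<le>n. exp (q (y k) (y k) * t k)))"

definition jump_time :: "path \<Rightarrow> nat \<Rightarrow> real" where
  "jump_time w n = (\<Sum>k<n. snd (w k))"

text \<open>
  State of the continuous-time chain at time \<open>t\<close>; the value \<open>None\<close> means that the chain has
  exploded by time \<open>t\<close> (it is never restarted, i.e. this is the minimal chain).
\<close>

definition chain_at :: "path \<Rightarrow> real \<Rightarrow> nat option" where
  "chain_at w t =
     (if \<exists>n. t < jump_time w (Suc n)
      then Some (fst (w (LEAST n. t < jump_time w (Suc n))))
      else None)"

text \<open>First return to \<open>i\<close> after the first jump; it is \<open>\<infinity>\<close> if there is no return.\<close>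

definition return_time :: "nat \<Rightarrow> path \<Rightarrow> ennreal" where
  "return_time i w =
     Inf {ennreal t | t. jump_time w 1 \<le> t \<and> chain_at w t = Some i}"

text \<open>In the following, \<open>P i\<close> is the law of the chain started in \<open>i\<close>.\<close>

definition irreducible_chain :: "(nat \<Rightarrow> path measure) \<Rightarrow> bool" where
  "irreducible_chain P \<longleftrightarrow>
     (\<forall>i j. 0 < measure (P i) {w \<in> space (P i). \<exists>t\<ge>0. chain_at w t = Some j})"

definition positive_recurrent_chain :: "(nat \<Rightarrow> path measure) \<Rightarrow> bool" where
  "positive_recurrent_chain P \<longleftrightarrow> (\<forall>i. (\<integral>\<^sup>+ w. return_time i w \<partial>P i) < \<infinity>)"

definition ergodic_generator :: "(nat \<Rightarrow> nat \<Rightarrow> real) \<Rightarrow> bool" where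
  "ergodic_generator q \<longleftrightarrow>
     conservative_q_matrix q \<and>
     (\<exists>P. (\<forall>i. ctmc_law q i (P i)) \<and> irreducible_chain P \<and> positive_recurrent_chain P)"

definition stationary_distribution :: "(nat \<Rightarrow> nat \<Rightarrow> real) \<Rightarrow> (nat \<Rightarrow> real) \<Rightarrow> bool" where
  "stationary_distribution q p \<longleftrightarrow>
     (\<forall>i. 0 < p i) \<and> (\<forall>j. (\<lambda>i. p i * q i j) sums 0) \<and> p sums 1"


section \<open>Northwest-corner truncations\<close>

definition nw_trunc :: "(nat \<Rightarrow> nat \<Rightarrow> real) \<Rightarrow> nat \<Rightarrow> real mat" where
  "nw_trunc q n = mat (n + 1) (n + 1) (\<lambda>(i, j). q i j)"

text \<open>The matrix inverse of \<open>- nw_trunc q n\<close>; \<open>mat_inverse\<close> returns \<open>None\<close> only for singular matrices.\<close>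

definition nw_inv :: "(nat \<Rightarrow> nat \<Rightarrow> real) \<Rightarrow> nat \<Rightarrow> real mat" where
  "nw_inv q n = the (mat_inverse (- nw_trunc q n))"

definition reach_set :: "(nat \<Rightarrow> nat \<Rightarrow> real) \<Rightarrow> nat set \<Rightarrow> nat \<Rightarrow> nat set" where
  "reach_set q B n = {v. v \<le> n \<and> 0 < (\<Sum>j\<in>B. nw_inv q n $$ (v, j))}"

definition prob_vector_upto :: "nat \<Rightarrow> (nat \<Rightarrow> real) \<Rightarrow> bool" where
  "prob_vector_upto n a \<longleftrightarrow> (\<forall>i\<le>n. 0 \<le> a i) \<and> (\<Sum>i\<le>n. a i) = 1"

definition row_upto :: "nat \<Rightarrow> (nat \<Rightarrow> real) \<Rightarrow> real mat" where
  "row_upto n a = mat 1 (n + 1) (\<lambda>(_, i). a i)"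

text \<open>
  Rows and columns indexed by a finite set \<open>B\<close> are listed in increasing order of \<open>B\<close>: position
  \<open>k < card B\<close> stands for the element \<open>sorted_list_of_set B ! k\<close>.
\<close>

definition col_selector :: "nat \<Rightarrow> nat set \<Rightarrow> real mat" where
  "col_selector n B =
     mat (n + 1) (card B) (\<lambda>(i, k). if i = sorted_list_of_set B ! k then 1 else 0)"

definition row_on :: "nat set \<Rightarrow> (nat \<Rightarrow> real) \<Rightarrow> real mat" where
  "row_on B p = mat 1 (card B) (\<lambda>(_, k). p (sorted_list_of_set B ! k))"

definition ones_col :: "nat \<Rightarrow> real mat" where
  "ones_col m = mat m 1 (\<lambda>_. 1)"

text \<open>A row vector \<open>v\<close> divided by the scalar \<open>v e\<close>.\<close>

definition normalize_row :: "real mat \<Rightarrow> real mat" where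
  "normalize_row v = inverse ((v * ones_col (dim_col v)) $$ (0, 0)) \<cdot>\<^sub>m v"

end

(*
  The inverse G of a truncated generator -[n]Q obeys a minimum principle, because irreducibility
  forbids finite closed sets. Hence every row z that is excessive for the truncation, i.e.
  z (-[n]Q) >= 0, satisfies z(j) >= z(l) G(l,j) / G(l,l). Both alpha G and the restriction of pi
  are excessive. Applied to pi for (l,j) and (j,l), the inequality squeezes G(l,j) / G(l,l) between
  h(l,j) h(j,l) pi(j)/pi(l) and pi(j)/pi(l), where h(x,l) = G(x,l) / G(l,l) is the probability
  of visiting l before leaving {0..n}. By recurrence h tends to 1, so G(l,j) / G(l,l) tends to
  pi(j)/pi(l); applied to alpha G, the same inequality in both directions forces its entries
  on B to have these ratios in the limit.
*)
theory Submission
  imports Defs "Jordan_Normal_Form.Determinant"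
begin

section \<open>The jump chain\<close>

text \<open>The probability that the first \<open>k\<close> jumps of the chain started in \<open>x\<close> all lead into \<open>S\<close>.\<close>

primrec surv :: "(nat \<Rightarrow> nat \<Rightarrow> real) \<Rightarrow> nat set \<Rightarrow> nat \<Rightarrow> nat \<Rightarrow> real" where
  "surv q S 0 x = 1"
| "surv q S (Suc k) x = (\<Sum>y. if y \<in> S then jump_prob q x y * surv q S k y else 0)"

lemma jump_prob_nonneg: "conservative_q_matrix q \<Longrightarrow> 0 \<le> jump_prob q i j"
  unfolding conservative_q_matrix_def jump_prob_def
  by (auto intro!: divide_nonneg_nonpos simp: less_imp_le)

lemma jump_prob_sums:
  assumes "conservative_q_matrix q"
  shows "jump_prob q i sums 1"
proof -
  have neg: "q i i < 0" and s: "q i sums 0"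
    using assms unfolding conservative_q_matrix_def by auto
  have "(\<lambda>j. q i j - (if j = i then q i i else 0)) sums (0 - q i i)"
    by (intro sums_diff s) (use sums_single[of i "\<lambda>_. q i i"] in simp)
  then have "(\<lambda>j. (q i j - (if j = i then q i i else 0)) / (- q i i)) sums ((0 - q i i) / (- q i i))"
    by (rule sums_divide)
  moreover have "(\<lambda>j. (q i j - (if j = i then q i i else 0)) / (- q i i)) = jump_prob q i"
    by (auto simp: fun_eq_iff jump_prob_def)
  ultimately show ?thesis using neg by simp
qed

lemma summable_jump_prob_weighted:
  assumes "conservative_q_matrix q" and "\<And>y. \<bar>f y\<bar> \<le> 1"
  shows "summable (\<lambda>y. jump_prob q x y * f y)"
proof (rule summable_comparison_test')
  show "summable (jump_prob q x)" using jump_prob_sums[OF assms(1)] sums_summable by blast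
  show "norm (jump_prob q x y * f y) \<le> jump_prob q x y" for y
    using mult_left_mono[OF assms(2) jump_prob_nonneg[OF assms(1)], of x y y]
    by (simp add: abs_mult jump_prob_nonneg[OF assms(1)])
qed

lemma surv_bounds:
  assumes q: "conservative_q_matrix q"
  shows "0 \<le> surv q S k x \<and> surv q S k x \<le> 1"
proof (induction k arbitrary: x)
  case (Suc k)
  let ?f = "\<lambda>y. jump_prob q x y * (if y \<in> S then surv q S k y else 0)"
  have eq: "surv q S (Suc k) x = suminf ?f"
    by (auto intro!: arg_cong[where f = suminf] simp: fun_eq_iff)
  have s: "summable ?f" using Suc by (intro summable_jump_prob_weighted q) auto
  have "suminf ?f \<le> suminf (jump_prob q x)"
    using Suc jump_prob_nonneg[OF q] jump_prob_sums[OF q] s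
    by (intro suminf_le) (auto simp: sums_iff mult_left_le)
  also have "\<dots> = 1" using jump_prob_sums[OF q] by (simp add: sums_iff)
  finally have "suminf ?f \<le> 1" .
  moreover have "0 \<le> suminf ?f"
    using Suc jump_prob_nonneg[OF q] s by (intro suminf_nonneg) auto
  ultimately show ?case unfolding eq by simp
qed simp

text \<open>Domination by the jump probabilities makes the series in the recursion converge, so its
  \<open>suminf\<close> is a genuine sum that can be matched against countable additivity.\<close>

lemma surv_sums:
  assumes q: "conservative_q_matrix q"
  shows "(\<lambda>y. if y \<in> S then jump_prob q x y * surv q S k y else 0) sums surv q S (Suc k) x"
proof -
  have "summable (\<lambda>y. jump_prob q x y * (if y \<in> S then surv q S k y else 0))"
    using surv_bounds[OF q] by (intro summable_jump_prob_weighted q) auto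
  moreover have "(\<lambda>y. jump_prob q x y * (if y \<in> S then surv q S k y else 0)) =
      (\<lambda>y. if y \<in> S then jump_prob q x y * surv q S k y else 0)"
    by auto
  ultimately show ?thesis by (simp add: summable_sums)
qed

text \<open>No positive jump probability leads out of \<open>C\<close>, so every step keeps the full
  mass 1.\<close>

lemma surv_closed:
  assumes q: "conservative_q_matrix q"
    and closed: "\<And>i j. i \<in> C \<Longrightarrow> i \<noteq> j \<Longrightarrow> 0 < q i j \<Longrightarrow> j \<in> C"
    and "x \<in> C"
  shows "surv q C k x = 1"
  using \<open>x \<in> C\<close>
proof (induction k arbitrary: x)
  case (Suc k)
  have "jump_prob q x y = 0" if "y \<notin> C" for y
    using closed[OF Suc.prems, of y] that q
    unfolding jump_prob_def conservative_q_matrix_def by (metis div_0 less_eq_real_def)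
  then have "(\<lambda>y. if y \<in> C then jump_prob q x y * surv q C k y else 0) = jump_prob q x"
    using Suc.IH by auto
  then show ?case using jump_prob_sums[OF q] by (simp add: sums_iff)
qed simp

section \<open>Path law and jump chain\<close>

lemma ctmc_law_measurable:
  assumes "ctmc_law q x M"
  shows "(\<lambda>w. fst (w k)) \<in> measurable M (count_space UNIV)"
    and "(\<lambda>w. snd (w k)) \<in> borel_measurable M"
proof -
  have s: "sets M = sets path_space" using assms unfolding ctmc_law_def by blast
  have "(\<lambda>w. w k) \<in> measurable M (count_space UNIV \<Otimes>\<^sub>M borel)"
    unfolding measurable_cong_sets[OF s refl] path_space_def
    by (rule measurable_component_singleton) simp
  then show "(\<lambda>w. fst (w k)) \<in> measurable M (count_space UNIV)"
    and "(\<lambda>w. snd (w k)) \<in> borel_measurable M"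
    by measurable
qed

text \<open>\<open>ctmc_law\<close> prescribes only probabilities of paths with named states.
  Splitting over the state at step \<open>Suc m\<close> extends this to steps merely confined to
  \<open>S\<close>. The named prefix grows as the confined part shrinks, hence the induction over
  arbitrary \<open>m\<close> and \<open>y\<close>.\<close>

lemma ctmc_law_prefix_then_in:
  assumes q: "conservative_q_matrix q" and law: "ctmc_law q x M"
  shows "measure M {w \<in> space M. (\<forall>k\<le>m. fst (w k) = y k \<and> 0 < snd (w k)) \<and>
      (\<forall>k\<in>{m<..m + n}. fst (w k) \<in> S \<and> 0 < snd (w k))} =
    (if y 0 = x then 1 else 0) * (\<Prod>k<m. jump_prob q (y k) (y (Suc k))) * surv q S n (y m)"
    (is "measure M (?E m n y) = ?c m y * surv q S n (y m)")
proof (induction n arbitrary: m y)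
  case 0
  have "measure M {w \<in> space M. \<forall>k\<le>m. fst (w k) = y k \<and> 0 < snd (w k)} = ?c m y"
    using law[unfolded ctmc_law_def, THEN conjunct2, THEN conjunct2,
        THEN spec[of _ m], THEN spec[of _ y], THEN spec[of _ "\<lambda>_. 0"]] by simp
  then show ?case by simp
next
  case (Suc n)
  note [measurable] = ctmc_law_measurable[OF law]
  interpret prob_space M using law unfolding ctmc_law_def by blast
  \<comment> \<open>States outside \<open>S\<close> contribute the empty set, so the pieces are
    indexed by all states and their probabilities match the terms of
    \<open>surv_sums\<close>.\<close>
  define A where "A z = (if z \<in> S then ?E (Suc m) n (y(Suc m := z)) else {})" for z
  have "A z = {w \<in> ?E m (Suc n) y. fst (w (Suc m)) = z}" for z
  proof (cases "z \<in> S")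
    case True
    have *: "(\<forall>k\<le>Suc m. P k) \<longleftrightarrow> (\<forall>k\<le>m. P k) \<and> P (Suc m)" for P
      using le_Suc_eq by auto
    have "{m<..m + Suc n} = insert (Suc m) {Suc m<..Suc m + n}" by auto
    then show ?thesis using True unfolding A_def * by auto
  qed (auto simp: A_def)
  then have A: "A = (\<lambda>z. {w \<in> ?E m (Suc n) y. fst (w (Suc m)) = z})" by auto
  have "range A \<subseteq> events" unfolding A by auto
  moreover have "disjoint_family A" unfolding A disjoint_family_on_def by auto
  ultimately have 1: "(\<lambda>z. prob (A z)) sums prob (\<Union>z. A z)" by (rule finite_measure_UNION)
  have 2: "(\<Union>z. A z) = ?E m (Suc n) y" unfolding A by auto
  have 3: "(\<lambda>z. prob (A z)) =
      (\<lambda>z. ?c m y * (if z \<in> S then jump_prob q (y m) z * surv q S n z else 0))"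
  proof
    fix z
    have "?c (Suc m) (y(Suc m := z)) = ?c m y * jump_prob q (y m) z" by simp
    then show "prob (A z) = ?c m y * (if z \<in> S then jump_prob q (y m) z * surv q S n z else 0)"
      unfolding A_def using Suc.IH[of "Suc m" "y(Suc m := z)"] by (simp add: mult.assoc)
  qed
  have "(\<lambda>z. ?c m y * (if z \<in> S then jump_prob q (y m) z * surv q S n z else 0)) sums
      (?c m y * surv q S (Suc n) (y m))"
    by (intro sums_mult surv_sums q)
  then show ?case using 1 unfolding 2 3 by (rule sums_unique2[symmetric])
qed

text \<open>Started in \<open>C\<close>, the chain almost surely stays there because all its
  survival probabilities are 1. A state outside \<open>C\<close> would then be visited with
  probability 0.\<close>

lemma irreducible_chain_closed_set:
  assumes q: "conservative_q_matrix q" and law: "\<And>i. ctmc_law q i (P i)"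
    and irr: "irreducible_chain P"
    and "C \<noteq> {}" and closed: "\<And>i j. i \<in> C \<Longrightarrow> i \<noteq> j \<Longrightarrow> 0 < q i j \<Longrightarrow> j \<in> C"
  shows "C = UNIV"
proof (rule ccontr)
  assume "C \<noteq> UNIV"
  then obtain i j where i: "i \<in> C" and j: "j \<notin> C" using \<open>C \<noteq> {}\<close> by auto
  note [measurable] = ctmc_law_measurable[OF law[of i]]
  interpret prob_space "P i" using law unfolding ctmc_law_def by blast
  let ?E = "\<lambda>n. {w \<in> space (P i). (\<forall>k\<le>0. fst (w k) = i \<and> 0 < snd (w k)) \<and>
      (\<forall>k\<in>{0<..0 + n}. fst (w k) \<in> C \<and> 0 < snd (w k))}"
  have "prob (?E n) = 1" for n
    using ctmc_law_prefix_then_in[OF q law, of i 0 "\<lambda>_. i" n C] surv_closed[OF q closed i]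
    by simp
  then have "AE w in P i. w \<in> ?E n" for n by (rule AE_prob_1)
  then have "AE w in P i. \<forall>n. w \<in> ?E n" by (simp add: AE_all_countable)
  then have "AE w in P i. \<not> (\<exists>k. fst (w k) = j)"
  proof eventually_elim
    case (elim w)
    have "fst (w k) \<in> C" for k
      using elim[THEN spec, of k] i by (cases "k = 0") auto
    then show ?case using j by auto
  qed
  moreover have ev: "{w \<in> space (P i). \<exists>k. fst (w k) = j} \<in> events" by measurable
  ultimately have "prob {w \<in> space (P i). \<exists>k. fst (w k) = j} = 0"
    using ev by (subst prob_eq_0) (auto elim!: eventually_mono)
  \<comment> \<open>Every value of \<open>chain_at\<close> is a state listed in the path, so a visit
    at a real time is also a visit of the jump chain. Only countably many steps occur in the larger
    event, whence its measurability \<open>ev\<close>.\<close>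
  moreover have "prob {w \<in> space (P i). \<exists>t\<ge>0. chain_at w t = Some j} \<le>
      prob {w \<in> space (P i). \<exists>k. fst (w k) = j}"
    by (intro finite_measure_mono ev) (auto simp: chain_at_def split: if_splits)
  ultimately show False
    using irr[unfolded irreducible_chain_def, THEN spec, of i, THEN spec, of j] by linarith
qed

section \<open>Return times and recurrence of the jump chain\<close>

text \<open>From the first jump time on, the index chosen by \<open>LEAST\<close> cannot be 0, so
  sitting in \<open>i\<close> would require a later jump into \<open>i\<close>. The set of return
  times is thus empty, and its infimum in \<open>ennreal\<close> is infinite.\<close>

lemma return_time_no_return:
  assumes "\<And>k. 0 < k \<Longrightarrow> fst (w k) \<noteq> i"
  shows "return_time i w = \<infinity>"
proof -
  have False if t: "jump_time w 1 \<le> t" "chain_at w t = Some i" for t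
  proof -
    let ?N = "LEAST n. t < jump_time w (Suc n)"
    have ex: "\<exists>n. t < jump_time w (Suc n)" and N: "fst (w ?N) = i"
      using t(2) by (auto simp: chain_at_def split: if_splits)
    then have "?N = 0" using assms by blast
    moreover have "t < jump_time w (Suc ?N)" using ex by (rule LeastI_ex)
    ultimately show False using t(1) by simp
  qed
  then have "{ennreal t | t. jump_time w 1 \<le> t \<and> chain_at w t = Some i} = {}" by blast
  then show ?thesis unfolding return_time_def by (simp only: Inf_empty infinity_ennreal_def)
qed

lemma positive_recurrent_chain_surv:
  assumes q: "conservative_q_matrix q" and law: "\<And>i. ctmc_law q i (P i)"
    and rec: "positive_recurrent_chain P"
  shows "(\<lambda>n. surv q (- {i}) n i) \<longlonglongrightarrow> 0"
proof -
  note [measurable] = ctmc_law_measurable[OF law[of i]]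
  interpret prob_space "P i" using law unfolding ctmc_law_def by blast
  define E where "E = {w \<in> space (P i). \<forall>k>0. fst (w k) \<noteq> i}"
  define F where "F n = {w \<in> space (P i). \<forall>k\<in>{0<..n}. fst (w k) \<noteq> i}" for n
  have [measurable]: "E \<in> events" "F n \<in> events" for n unfolding E_def F_def by measurable
  \<comment> \<open>The return time is infinite on the event \<open>E\<close> of no return, so a
    positive probability of \<open>E\<close> would contradict the finite mean.\<close>
  have "\<infinity> * emeasure (P i) E = (\<integral>\<^sup>+ w. \<infinity> * indicator E w \<partial>P i)"
    by (subst nn_integral_cmult_indicator) auto
  also have "\<dots> \<le> (\<integral>\<^sup>+ w. return_time i w \<partial>P i)"
    by (intro nn_integral_mono)
      (auto simp: indicator_def E_def return_time_no_return split: if_splits)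
  also have "\<dots> < \<infinity>" using rec unfolding positive_recurrent_chain_def by blast
  finally have "emeasure (P i) E = 0"
    by (metis ennreal_top_mult infinity_ennreal_def less_irrefl)
  then have "prob E = 0" by (simp add: measure_def)
  moreover have "(\<Inter>n. F n) = E"
  proof
    show "(\<Inter>n. F n) \<subseteq> E"
    proof
      fix w assume "w \<in> (\<Inter>n. F n)"
      then have w: "w \<in> F k" for k by blast
      have "fst (w k) \<noteq> i" if "0 < k" for k using w[of k] that by (simp add: F_def)
      then show "w \<in> E" using w[of 0] by (simp add: E_def F_def)
    qed
    show "E \<subseteq> (\<Inter>n. F n)" by (simp add: E_def F_def subset_iff)
  qed
  moreover have "(\<lambda>n. prob (F n)) \<longlonglongrightarrow> prob (\<Inter>n. F n)"
    by (rule finite_Lim_measure_decseq) (auto simp: decseq_def F_def)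
  ultimately have lim: "(\<lambda>n. prob (F n)) \<longlonglongrightarrow> 0" by simp
  have "surv q (- {i}) n i \<le> prob (F n)" for n
  proof -
    have "surv q (- {i}) n i = prob {w \<in> space (P i). (\<forall>k\<le>0. fst (w k) = i \<and> 0 < snd (w k)) \<and>
      (\<forall>k\<in>{0<..0 + n}. fst (w k) \<in> - {i} \<and> 0 < snd (w k))}"
      using ctmc_law_prefix_then_in[OF q law, of i 0 "\<lambda>_. i" n "- {i}"] by simp
    also have "\<dots> \<le> prob (F n)" by (intro finite_measure_mono) (auto simp: F_def)
    finally show ?thesis .
  qed
  then show ?thesis
    using surv_bounds[OF q] by (intro tendsto_sandwich[OF _ _ tendsto_const lim]) auto
qed

section \<open>Irreducible generators and their truncations\<close>

text \<open>Irreducibility without path measures: there is no proper nonempty closed set. This is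
  the form that the minimum principle consumes.\<close>

locale irreducible_q_matrix =
  fixes q :: "nat \<Rightarrow> nat \<Rightarrow> real"
  assumes conservative: "conservative_q_matrix q"
    and closed_set: "C \<noteq> {} \<Longrightarrow> (\<And>i j. i \<in> C \<Longrightarrow> i \<noteq> j \<Longrightarrow> 0 < q i j \<Longrightarrow> j \<in> C) \<Longrightarrow> C = UNIV"
begin

text \<open>The Green function of the chain killed on leaving \<open>{..n}\<close>: the expected
  time spent in \<open>j\<close> when starting from \<open>i\<close>.\<close>

abbreviation "G n i j \<equiv> nw_inv q n $$ (i, j)"

lemma diag_neg: "q i i < 0" and offdiag_nonneg: "i \<noteq> j \<Longrightarrow> 0 \<le> q i j" and row_sums: "q i sums 0"
  using conservative unfolding conservative_q_matrix_def by auto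

lemma truncated_row_sum_le:
  assumes "i \<le> n"
  shows "(\<Sum>j\<le>n. q i j) \<le> 0"
proof -
  have "(\<Sum>j\<le>n. q i j) \<le> suminf (q i)"
    using row_sums assms by (intro sum_le_suminf) (auto simp: sums_iff intro!: offdiag_nonneg)
  then show ?thesis using row_sums by (simp add: sums_iff)
qed

text \<open>
  A negative minimum outside \<open>O'\<close> propagates to all successors, so the set of minimisers
  would be closed under \<open>q\<close>, contradicting irreducibility because it is finite.
\<close>

lemma truncated_minimum_principle:
  assumes super: "\<And>i. i \<le> n \<Longrightarrow> i \<notin> O' \<Longrightarrow> 0 \<le> (\<Sum>j\<le>n. - q i j * \<phi> j)"
    and bdry: "\<And>i. i \<in> O' \<Longrightarrow> 0 \<le> \<phi> i"
    and "i \<le> n"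
  shows "0 \<le> \<phi> i"
proof (rule ccontr)
  assume neg: "\<not> 0 \<le> \<phi> i"
  define m where "m = Min (\<phi> ` {..n})"
  have m_le: "m \<le> \<phi> j" if "j \<le> n" for j unfolding m_def using that by auto
  have m_neg: "m < 0" using m_le[OF \<open>i \<le> n\<close>] neg by linarith
  define C where "C = {j. j \<le> n \<and> \<phi> j = m}"
  have "m \<in> \<phi> ` {..n}" unfolding m_def by (rule Min_in) auto
  then have "C \<noteq> {}" unfolding C_def by auto
  moreover have "l \<in> C" if "k \<in> C" "k \<noteq> l" "0 < q k l" for k l
  proof -
    have k: "k \<le> n" "\<phi> k = m" using that unfolding C_def by auto
    have "k \<notin> O'" using bdry[of k] k m_neg by auto
    then have "0 \<le> (\<Sum>j\<le>n. - q k j * \<phi> j)" using super k by blast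
    \<comment> \<open>Writing \<open>- \<phi> j\<close> as \<open>(m - \<phi> j) - m\<close>
      separates the gap to the minimum from the row deficit. Both parts are nonpositive, so both
      vanish: the first makes successors within \<open>{..n}\<close> minimal, the second forbids
      successors beyond \<open>n\<close>.\<close>
    also have "\<dots> = (\<Sum>j\<le>n. q k j * (m - \<phi> j)) + (\<Sum>j\<le>n. q k j) * (- m)"
      by (simp add: right_diff_distrib sum_subtractf sum_negf sum_distrib_right)
    finally have *: "0 \<le> (\<Sum>j\<le>n. q k j * (m - \<phi> j)) + (\<Sum>j\<le>n. q k j) * (- m)" .
    have term_le: "q k j * (m - \<phi> j) \<le> 0" if "j \<le> n" for j
      using offdiag_nonneg[of k j] m_le[OF that] k by (cases "k = j") (auto intro: mult_nonneg_nonpos)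
    have s1: "(\<Sum>j\<le>n. q k j * (m - \<phi> j)) \<le> 0" using term_le by (auto intro: sum_nonpos)
    have s2: "(\<Sum>j\<le>n. q k j) * (- m) \<le> 0"
      using truncated_row_sum_le[OF k(1)] m_neg by (intro mult_nonpos_nonneg) auto
    have z1: "(\<Sum>j\<le>n. q k j * (m - \<phi> j)) = 0" and z2: "(\<Sum>j\<le>n. q k j) = 0"
    proof -
      have "(\<Sum>j\<le>n. q k j) * (- m) = 0" using * s1 s2 by linarith
      then show "(\<Sum>j\<le>n. q k j) = 0" using m_neg by simp
      show "(\<Sum>j\<le>n. q k j * (m - \<phi> j)) = 0" using * s1 s2 by linarith
    qed
    have "l \<le> n"
    proof (rule ccontr)
      assume "\<not> l \<le> n"
      then have "(\<Sum>j\<le>n. q k j) < (\<Sum>j\<in>insert l {..n}. q k j)" using that(3) by simp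
      also have "\<dots> \<le> (\<Sum>j\<le>l. q k j)"
        using k \<open>\<not> l \<le> n\<close> by (intro sum_mono2) (auto intro!: offdiag_nonneg)
      also have "\<dots> \<le> 0" using truncated_row_sum_le[of k l] k \<open>\<not> l \<le> n\<close> by simp
      finally show False using z2 by simp
    qed
    moreover have "(\<Sum>j\<le>n. - (q k j * (m - \<phi> j))) = 0" using z1 by (simp add: sum_negf)
    then have "\<forall>j\<in>{..n}. - (q k j * (m - \<phi> j)) = 0"
      using term_le by (subst (asm) sum_nonneg_eq_0_iff) auto
    then have "q k l * (m - \<phi> l) = 0" using \<open>l \<le> n\<close> by simp
    ultimately show "l \<in> C" using that(3) unfolding C_def by auto
  qed
  ultimately have "C = UNIV" by (rule closed_set)
  moreover have "Suc n \<notin> C" unfolding C_def by simp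
  ultimately show False by blast
qed

section \<open>Existence of the truncated inverse and bounds on its entries\<close>

text \<open>A kernel vector and its negative both obey the minimum principle with no exceptional
  states, so the kernel is trivial. Hence \<open>the\<close> in \<open>nw_inv\<close> is applied to
  an actual inverse.\<close>

lemma nw_inv_inverse:
  shows "- nw_trunc q n * nw_inv q n = 1\<^sub>m (n + 1)"
    and "nw_inv q n * (- nw_trunc q n) = 1\<^sub>m (n + 1)"
    and "nw_inv q n \<in> carrier_mat (n + 1) (n + 1)"
proof -
  let ?A = "- nw_trunc q n"
  have A: "?A \<in> carrier_mat (n + 1) (n + 1)" by (simp add: nw_trunc_def)
  have "Determinant.det ?A \<noteq> 0"
  proof
    assume "Determinant.det ?A = 0"
    then obtain v where v: "v \<in> carrier_vec (n + 1)" "v \<noteq> 0\<^sub>v (n + 1)" "?A *\<^sub>v v = 0\<^sub>v (n + 1)"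
      using det_0_iff_vec_prod_zero_field[OF A] by auto
    define u where "u = vec_index v"
    have harm: "(\<Sum>j\<le>n. - q i j * u j) = 0" if "i \<le> n" for i
    proof -
      have "vec_index (?A *\<^sub>v v) i = (\<Sum>j\<in>{0..<n + 1}. - q i j * u j)"
        using that v(1) by (auto simp: nw_trunc_def scalar_prod_def u_def sum_negf)
      then show ?thesis using v(3) that by (simp add: atMost_atLeast0 atLeastLessThanSuc_atLeastAtMost)
    qed
    have "u i = 0" if "i \<le> n" for i
    proof (rule antisym)
      show "0 \<le> u i"
        by (rule truncated_minimum_principle[of n "{}" u]) (simp_all only: harm that empty_iff order_refl)
      have harm_neg: "(\<Sum>j\<le>n. - q i j * - u j) = 0" if "i \<le> n" for i
        using harm[OF that] by (simp add: sum_negf)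
      have "0 \<le> - u i"
        by (rule truncated_minimum_principle[of n "{}" "\<lambda>i. - u i"])
          (simp_all only: harm_neg that empty_iff order_refl)
      then show "u i \<le> 0" by simp
    qed
    then have "v = 0\<^sub>v (n + 1)" using v(1) by (intro eq_vecI) (auto simp: u_def)
    then show False using v(2) by blast
  qed
  then have "?A \<in> Units (ring_mat TYPE(real) (n + 1) ())" by (rule det_non_zero_imp_unit[OF A])
  then obtain X where X: "mat_inverse ?A = Some X" using mat_inverse(1)[OF A, where b = "()"] by (cases "mat_inverse ?A") auto
  then have "nw_inv q n = X" by (simp add: nw_inv_def)
  then show "?A * nw_inv q n = 1\<^sub>m (n + 1)" "nw_inv q n * ?A = 1\<^sub>m (n + 1)"
    "nw_inv q n \<in> carrier_mat (n + 1) (n + 1)"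
    using mat_inverse(2)[OF A X] by auto
qed

lemma trunc_times_inv:
  assumes "i \<le> n" "j \<le> n"
  shows "(\<Sum>k\<le>n. - q i k * G n k j) = (if i = j then 1 else 0)"
proof -
  have "(- nw_trunc q n * nw_inv q n) $$ (i, j) = (\<Sum>k\<in>{0..<n + 1}. - q i k * G n k j)"
    using assms nw_inv_inverse(3)[of n] by (auto simp: nw_trunc_def scalar_prod_def sum_negf)
  then show ?thesis
    using assms by (simp add: nw_inv_inverse(1) atMost_atLeast0 atLeastLessThanSuc_atLeastAtMost)
qed

lemma inv_times_trunc:
  assumes "i \<le> n" "j \<le> n"
  shows "(\<Sum>k\<le>n. G n i k * - q k j) = (if i = j then 1 else 0)"
proof -
  have "(nw_inv q n * (- nw_trunc q n)) $$ (i, j) = (\<Sum>k\<in>{0..<n + 1}. G n i k * - q k j)"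
    using assms nw_inv_inverse(3)[of n] by (auto simp: nw_trunc_def scalar_prod_def sum_negf)
  then show ?thesis
    using assms by (simp add: nw_inv_inverse(2) atMost_atLeast0 atLeastLessThanSuc_atLeastAtMost)
qed

lemma nw_inv_nonneg:
  assumes "i \<le> n" "j \<le> n"
  shows "0 \<le> G n i j"
proof (rule truncated_minimum_principle[of n "{}" "\<lambda>i. G n i j"])
  fix k assume "k \<le> n"
  then show "0 \<le> (\<Sum>l\<le>n. - q k l * G n l j)" by (subst trunc_times_inv) (auto simp: assms)
qed (auto simp: assms)

text \<open>As a function of \<open>i\<close>, the difference vanishes at \<open>j\<close>.
  Elsewhere it is superharmonic, since column \<open>j\<close> of the inverse is harmonic there and
  constants are superharmonic by the nonpositive row sums.\<close>

lemma nw_inv_le_diag: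
  assumes "i \<le> n" "j \<le> n"
  shows "G n i j \<le> G n j j"
proof -
  have "0 \<le> G n j j - G n i j"
  proof (rule truncated_minimum_principle[of n "{j}" "\<lambda>i. G n j j - G n i j"])
    fix k assume k: "k \<le> n" "k \<notin> {j}"
    have "(\<Sum>l\<le>n. - q k l * (G n j j - G n l j)) =
        - (\<Sum>l\<le>n. q k l) * G n j j - (\<Sum>l\<le>n. - q k l * G n l j)"
      by (simp add: right_diff_distrib sum_subtractf sum_negf sum_distrib_right)
    also have "\<dots> \<ge> 0"
      using k assms truncated_row_sum_le[of k n] nw_inv_nonneg[of j n j]
      by (subst trunc_times_inv) (auto simp: mult_nonpos_nonneg)
    finally show "0 \<le> (\<Sum>l\<le>n. - q k l * (G n j j - G n l j))" .
  qed (use assms in auto)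
  then show ?thesis by simp
qed

text \<open>The diagonal entry dominates its column, so if it were 0 the column would vanish and
  could not belong to an inverse.\<close>

lemma nw_inv_diag_pos:
  assumes "j \<le> n"
  shows "0 < G n j j"
proof (rule ccontr)
  assume "\<not> 0 < G n j j"
  then have "G n k j = 0" if "k \<le> n" for k
    using nw_inv_le_diag[OF that assms] nw_inv_nonneg[OF that assms] by linarith
  then have "(\<Sum>k\<le>n. - q j k * G n k j) = 0" by simp
  then show False using trunc_times_inv[OF assms assms] by simp
qed

text \<open>Divided by \<open>G n l l\<close>, this says that the time spent in \<open>j\<close>
  after first visiting \<open>l\<close> is part of the total time in \<open>j\<close>. The
  difference vanishes at \<open>i = l\<close> and is superharmonic elsewhere.\<close>

lemma nw_inv_minor:
  assumes "i \<le> n" "j \<le> n" "l \<le> n"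
  shows "G n i l * G n l j \<le> G n i j * G n l l"
proof -
  have "0 \<le> G n i j * G n l l - G n i l * G n l j"
  proof (rule truncated_minimum_principle[of n "{l}" "\<lambda>i. G n i j * G n l l - G n i l * G n l j"])
    fix k assume k: "k \<le> n" "k \<notin> {l}"
    have "(\<Sum>m\<le>n. - q k m * (G n m j * G n l l - G n m l * G n l j)) =
        (\<Sum>m\<le>n. - q k m * G n m j) * G n l l - (\<Sum>m\<le>n. - q k m * G n m l) * G n l j"
      unfolding right_diff_distrib sum_subtractf sum_distrib_right by (simp only: mult.assoc)
    also have "\<dots> \<ge> 0" using k assms nw_inv_nonneg[of l n l] by (simp add: trunc_times_inv[simplified])
    finally show "0 \<le> (\<Sum>m\<le>n. - q k m * (G n m j * G n l l - G n m l * G n l j))" .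
  qed (use assms in auto)
  then show ?thesis by simp
qed

section \<open>Excessive rows of the truncation\<close>

text \<open>The row \<open>z\<close> is the combination of the rows of \<open>G n\<close> with the
  nonnegative weights \<open>w\<close>, the image of \<open>z\<close> under the negated truncation.
  Each row satisfies the inequality by \<open>nw_inv_minor\<close>.\<close>

lemma excessive_lower_bound:
  assumes ex: "\<And>j. j \<le> n \<Longrightarrow> 0 \<le> (\<Sum>i\<le>n. z i * - q i j)"
    and "j \<le> n" "l \<le> n"
  shows "z l * G n l j \<le> z j * G n l l"
proof -
  define w where "w j = (\<Sum>i\<le>n. z i * - q i j)" for j
  have z: "z k = (\<Sum>i\<le>n. w i * G n i k)" if "k \<le> n" for k
  proof -
    have "(\<Sum>i\<le>n. w i * G n i k) = (\<Sum>i\<le>n. \<Sum>m\<le>n. z m * (- q m i * G n i k))"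
      unfolding w_def sum_distrib_right by (simp only: mult.assoc)
    also have "\<dots> = (\<Sum>m\<le>n. z m * (\<Sum>i\<le>n. - q m i * G n i k))"
      by (subst sum.swap) (simp only: sum_distrib_left)
    also have "\<dots> = (\<Sum>m\<le>n. z m * (if m = k then 1 else 0))"
      using that by (intro sum.cong refl) (simp only: trunc_times_inv atMost_iff)
    also have "\<dots> = z k" using that by (simp add: if_distrib cong: if_cong)
    finally show ?thesis by simp
  qed
  have "z l * G n l j = (\<Sum>i\<le>n. w i * (G n i l * G n l j))"
    by (simp add: z[OF assms(3)] sum_distrib_right mult.assoc)
  also have "\<dots> \<le> (\<Sum>i\<le>n. w i * (G n i j * G n l l))"
    using assms(2,3) by (intro sum_mono mult_left_mono nw_inv_minor) (auto simp only: w_def ex atMost_iff)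
  also have "\<dots> = z j * G n l l"
    by (simp add: z[OF assms(2)] sum_distrib_right mult.assoc)
  finally show ?thesis .
qed

text \<open>The negated truncation cancels its inverse and returns the nonnegative row
  \<open>a\<close>.\<close>

lemma prob_row_excessive:
  assumes "\<And>i. i \<le> n \<Longrightarrow> 0 \<le> a i" and "j \<le> n"
  shows "0 \<le> (\<Sum>i\<le>n. (\<Sum>k\<le>n. a k * G n k i) * - q i j)"
proof -
  have "(\<Sum>i\<le>n. (\<Sum>k\<le>n. a k * G n k i) * - q i j) = (\<Sum>i\<le>n. \<Sum>k\<le>n. a k * (G n k i * - q i j))"
    unfolding sum_distrib_right by (simp only: mult.assoc)
  also have "\<dots> = (\<Sum>k\<le>n. a k * (\<Sum>i\<le>n. G n k i * - q i j))"
    by (subst sum.swap) (simp only: sum_distrib_left)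
  also have "\<dots> = (\<Sum>k\<le>n. a k * (if k = j then 1 else 0))"
    using assms(2) by (intro sum.cong refl) (simp only: inv_times_trunc atMost_iff)
  also have "\<dots> = a j" using assms(2) by (simp add: if_distrib cong: if_cong)
  finally show ?thesis using assms by simp
qed

text \<open>The full column sum is 0, and the terms cut off have \<open>i > n \<ge> j\<close>, so
  they are off-diagonal and nonnegative.\<close>

lemma stationary_excessive:
  assumes p: "stationary_distribution q p" and "j \<le> n"
  shows "0 \<le> (\<Sum>i\<le>n. p i * - q i j)"
proof -
  have pos: "0 < p i" and s: "(\<lambda>i. p i * q i j) sums 0" for i
    using p unfolding stationary_distribution_def by auto
  have "(\<Sum>i\<le>n. p i * q i j) \<le> suminf (\<lambda>i. p i * q i j)"
    using s assms(2) pos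
    by (intro sum_le_suminf) (auto simp: sums_iff less_imp_le intro!: mult_nonneg_nonneg offdiag_nonneg)
  then show ?thesis using s by (simp add: sums_iff sum_negf)
qed

end

section \<open>Recurrence and convergence of the truncations\<close>

locale recurrent_q_matrix = irreducible_q_matrix +
  assumes recurrent: "(\<lambda>k. surv q (- {i}) k i) \<longlonglongrightarrow> 0"
begin

text \<open>The states from which \<open>l\<close> is avoided forever with probability 0 include
  \<open>l\<close> and form a closed set: avoiding \<open>l\<close> from a successor
  \<open>j\<close> with positive probability would make it possible from \<open>i\<close> as
  well.\<close>

lemma surv_tendsto_0: "(\<lambda>k. surv q (- {l}) k x) \<longlonglongrightarrow> 0"
proof -
  let ?C = "{x. (\<lambda>k. surv q (- {l}) k x) \<longlonglongrightarrow> 0}"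
  have "?C = UNIV"
  proof (rule closed_set)
    show "?C \<noteq> {}" using recurrent[of l] by blast
    fix i j assume i: "i \<in> ?C" and ij: "i \<noteq> j" "0 < q i j"
    show "j \<in> ?C"
    proof (cases "j = l")
      case False
      have J: "0 < jump_prob q i j" using ij diag_neg[of i] by (simp add: jump_prob_def divide_pos_neg)
      \<comment> \<open>Of the first-step decomposition from \<open>i\<close>, only the term of the
        jump to \<open>j\<close> is kept.\<close>
      have le: "surv q (- {l}) k j \<le> surv q (- {l}) (Suc k) i / jump_prob q i j" for k
      proof -
        let ?f = "\<lambda>y. if y \<in> - {l} then jump_prob q i y * surv q (- {l}) k y else 0"
        have s: "?f sums surv q (- {l}) (Suc k) i" by (rule surv_sums[OF conservative])
        have "0 \<le> ?f y" for y
          using surv_bounds[OF conservative] jump_prob_nonneg[OF conservative] by simp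
        then have "sum ?f {j} \<le> suminf ?f"
          using s by (intro sum_le_suminf) (auto simp only: sums_iff finite.intros)
        then have "jump_prob q i j * surv q (- {l}) k j \<le> surv q (- {l}) (Suc k) i"
          using False sums_unique[OF s] by (simp del: surv.simps)
        then show ?thesis using J by (simp add: pos_le_divide_eq mult.commute del: surv.simps)
      qed
      have "(\<lambda>k. surv q (- {l}) (Suc k) i) \<longlonglongrightarrow> 0" using i by (subst filterlim_sequentially_Suc) blast
      from tendsto_divide[OF this tendsto_const[of "jump_prob q i j"]]
      have lim: "(\<lambda>k. surv q (- {l}) (Suc k) i / jump_prob q i j) \<longlonglongrightarrow> 0" using J by simp
      have "(\<lambda>k. surv q (- {l}) k j) \<longlonglongrightarrow> 0"
        using surv_bounds[OF conservative] le
        by (intro tendsto_sandwich[OF _ _ tendsto_const lim] always_eventually) auto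
      then show ?thesis by simp
    qed (use recurrent in simp)
  qed
  then show ?thesis by blast
qed

text \<open>
  The probability that the chain started in \<open>x\<close> leaves \<open>{..n}\<close> before it visits \<open>l\<close>
  (and \<open>1\<close> if \<open>l > n\<close>).
\<close>

definition escape :: "nat \<Rightarrow> nat \<Rightarrow> nat \<Rightarrow> real" where
  "escape l n x = 1 - (if x \<le> n \<and> l \<le> n then G n x l / G n l l else 0)"

lemma escape_bounds: "0 \<le> escape l n x" "escape l n x \<le> 1"
  using nw_inv_nonneg[of x n l] nw_inv_le_diag[of x n l] nw_inv_diag_pos[of l n]
  by (auto simp: escape_def pos_divide_le_eq intro: divide_nonneg_pos)

text \<open>First-step analysis, read off from row \<open>x\<close> of the inverse relation.
  Extending the column ratio by 0 beyond \<open>n\<close> turns the finite sum into a series over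
  all states, which is then subtracted from the total jump probability 1.\<close>

lemma escape_harmonic:
  assumes "x \<le> n" "l \<le> n" "x \<noteq> l"
  shows "(\<lambda>y. jump_prob q x y * escape l n y) sums escape l n x"
proof -
  have "q x y = - q x x * (jump_prob q x y - (if y = x then 1 else 0))" for y
    using diag_neg[of x] by (auto simp: jump_prob_def)
  then have "(\<Sum>y\<le>n. - q x y * G n y l) =
      (\<Sum>y\<le>n. q x x * (jump_prob q x y * G n y l - (if y = x then G n x l else 0)))"
    by (intro sum.cong refl) (auto simp: jump_prob_def)
  also have "\<dots> = q x x * ((\<Sum>y\<le>n. jump_prob q x y * G n y l) - G n x l)"
    using assms(1) by (simp add: sum_subtractf flip: sum_distrib_left)
  finally have "q x x * ((\<Sum>y\<le>n. jump_prob q x y * G n y l) - G n x l) = 0"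
    using trunc_times_inv[OF assms(1,2)] assms(3) by simp
  then have eq: "(\<Sum>y\<le>n. jump_prob q x y * G n y l) = G n x l"
    using diag_neg[of x] by simp
  let ?h = "\<lambda>y. jump_prob q x y * (if y \<le> n then G n y l / G n l l else 0)"
  have "?h sums (\<Sum>y\<le>n. ?h y)" by (rule sums_finite) auto
  also have "(\<Sum>y\<le>n. ?h y) = (\<Sum>y\<le>n. jump_prob q x y * G n y l) / G n l l"
    by (simp add: sum_divide_distrib)
  finally have "?h sums (G n x l / G n l l)" unfolding eq .
  from sums_diff[OF jump_prob_sums[OF conservative, of x] this]
  show ?thesis using assms by (simp add: escape_def right_diff_distrib if_distrib cong: if_cong)
qed

text \<open>The convergence of the maximum encodes that the limsup of \<open>escape l n x\<close>
  over \<open>n\<close> is at most \<open>surv q (- {l}) k x\<close>, for each fixed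
  \<open>k\<close>. Induction on \<open>k\<close> takes one jump at a time, and the jump
  probabilities dominate the series when limit and sum are exchanged.\<close>

lemma escape_limit_le_surv:
  "(\<lambda>n. max (escape l n x) (surv q (- {l}) k x)) \<longlonglongrightarrow> surv q (- {l}) k x"
proof (induction k arbitrary: x)
  case 0
  then show ?case using escape_bounds by (simp add: max_absorb2)
next
  case (Suc k)
  note J = jump_prob_nonneg[OF conservative]
  \<comment> \<open>For \<open>n \<ge> l\<close> this bounds \<open>escape l n y\<close> from above,
    which is 0 at \<open>y = l\<close>; the maximum makes the induction hypothesis give its
    limit.\<close>
  define g where "g n y = (if y = l then 0 else max (escape l n y) (surv q (- {l}) k y))" for n y
  have g: "0 \<le> g n y \<and> g n y \<le> 1" for n y
    using escape_bounds[of l n y] surv_bounds[OF conservative, of "- {l}" k y]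
    by (auto simp: g_def)
  have g_sum: "summable (\<lambda>y. jump_prob q x y * g n y)" for n
    using g by (intro summable_jump_prob_weighted conservative) auto
  define R where "R n = (\<Sum>y. jump_prob q x y * g n y)" for n
  have "R \<longlonglongrightarrow> (\<Sum>y. if y \<in> - {l} then jump_prob q x y * surv q (- {l}) k y else 0)"
    unfolding R_def
  proof (rule tannerys_theorem[THEN conjunct2, THEN conjunct2])
    show "(\<lambda>n. jump_prob q x y * g n y) \<longlonglongrightarrow>
        (if y \<in> - {l} then jump_prob q x y * surv q (- {l}) k y else 0)" for y
      using tendsto_mult_left[OF Suc, of "jump_prob q x y" y] by (auto simp: g_def)
    show "\<forall>\<^sub>F (y, n) in at_top \<times>\<^sub>F sequentially. norm (jump_prob q x y * g n y) \<le> jump_prob q x y"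
      using g J by (intro always_eventually) (auto simp: abs_mult intro!: mult_left_le)
    show "summable (jump_prob q x)" using jump_prob_sums[OF conservative] sums_summable by blast
  qed simp
  then have R: "R \<longlonglongrightarrow> surv q (- {l}) (Suc k) x" by simp
  have "escape l n x \<le> max (R n) (surv q (- {l}) (Suc k) x)" if n: "max x l \<le> n" for n
  proof (cases "x = l")
    case True
    then have "escape l n x = 0" using n nw_inv_diag_pos[of l n] by (simp add: escape_def)
    then show ?thesis
      using surv_bounds[OF conservative, of "- {l}" "Suc k" x] by (simp add: le_max_iff_disj del: surv.simps)
  next
    case False
    have l0: "escape l n l = 0" using n nw_inv_diag_pos[of l n] by (simp add: escape_def)
    have s: "(\<lambda>y. jump_prob q x y * escape l n y) sums escape l n x"
      using False n by (intro escape_harmonic) auto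
    have "(\<Sum>y. jump_prob q x y * escape l n y) \<le> R n"
      unfolding R_def
    proof (rule suminf_le[OF _ _ g_sum])
      show "jump_prob q x y * escape l n y \<le> jump_prob q x y * g n y" for y
        using J[of x y] l0 by (intro mult_left_mono) (auto simp: g_def)
    qed (use s sums_summable in blast)
    then show ?thesis using sums_unique[OF s] by simp
  qed
  then have ev: "\<forall>\<^sub>F n in sequentially. max (escape l n x) (surv q (- {l}) (Suc k) x) \<le>
      max (R n) (surv q (- {l}) (Suc k) x)"
    unfolding eventually_sequentially
    by (intro exI[of _ "max x l"] allI impI max.boundedI max.cobounded2) blast
  have lim: "(\<lambda>n. max (R n) (surv q (- {l}) (Suc k) x)) \<longlonglongrightarrow> surv q (- {l}) (Suc k) x"
    using tendsto_max[OF R tendsto_const[of "surv q (- {l}) (Suc k) x"]] by (simp del: surv.simps)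
  show ?case
    by (rule tendsto_sandwich[OF _ ev tendsto_const lim]) (simp del: surv.simps)
qed

text \<open>First \<open>k\<close> is chosen to make the survival probability small, then
  \<open>n\<close> is sent to infinity.\<close>

lemma escape_tendsto_0: "(\<lambda>n. escape l n x) \<longlonglongrightarrow> 0"
proof (rule order_tendstoI)
  show "\<forall>\<^sub>F n in sequentially. a < escape l n x" if "a < 0" for a
    using escape_bounds(1) that by (intro always_eventually) (auto intro: less_le_trans)
  fix a :: real assume "0 < a"
  then have "\<forall>\<^sub>F k in sequentially. surv q (- {l}) k x < a"
    using order_tendstoD(2)[OF surv_tendsto_0] by blast
  then obtain k where "surv q (- {l}) k x < a"
    using eventually_happens by force
  then have "\<forall>\<^sub>F n in sequentially. max (escape l n x) (surv q (- {l}) k x) < a"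
    by (rule order_tendstoD(2)[OF escape_limit_le_surv])
  then show "\<forall>\<^sub>F n in sequentially. escape l n x < a" by (rule eventually_mono) simp
qed

lemma nw_inv_column_ratio_tendsto_1: "(\<lambda>n. G n x l / G n l l) \<longlonglongrightarrow> 1"
proof (rule Lim_transform_eventually)
  show "(\<lambda>n. 1 - escape l n x) \<longlonglongrightarrow> 1"
    using tendsto_diff[OF tendsto_const[of 1] escape_tendsto_0] by simp
  show "\<forall>\<^sub>F n in sequentially. 1 - escape l n x = G n x l / G n l l"
    unfolding eventually_sequentially by (intro exI[of _ "max x l"]) (simp add: escape_def)
qed

section \<open>Ratio limits for the inverse and for normalised excessive rows\<close>

lemma nw_inv_row_ratio_tendsto:
  assumes p: "stationary_distribution q p"
  shows "(\<lambda>n. G n l j / G n l l) \<longlonglongrightarrow> p j / p l"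
proof -
  have pos: "0 < p i" for i using p unfolding stationary_distribution_def by auto
  have upper: "G n l j / G n l l \<le> p j / p l" if "l \<le> n" "j \<le> n" for n l j
    using excessive_lower_bound[OF stationary_excessive[OF p], of n j l] that pos[of l]
      nw_inv_diag_pos[of l n] by (simp add: field_simps)
  \<comment> \<open>Both leading factors are column ratios and tend to 1. Exchanging their
    denominators makes them row ratios, and \<open>upper\<close> with \<open>j\<close> and
    \<open>l\<close> swapped bounds the second by \<open>p l / p j\<close>.\<close>
  let ?F = "\<lambda>n. (G n l j / G n j j) * (G n j l / G n l l) * (p j / p l)"
  have "?F \<longlonglongrightarrow> 1 * 1 * (p j / p l)"
    by (intro tendsto_mult nw_inv_column_ratio_tendsto_1 tendsto_const)
  then have lim: "?F \<longlonglongrightarrow> p j / p l" by simp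
  have lower: "?F n \<le> G n l j / G n l l" if n: "l \<le> n" "j \<le> n" for n
  proof -
    have "?F n = (G n l j / G n l l) * ((G n j l / G n j j) * (p j / p l))"
      by (simp add: mult_ac)
    also have "\<dots> \<le> (G n l j / G n l l) * ((p l / p j) * (p j / p l))"
      using n upper[of j n l] nw_inv_nonneg[of l n j] nw_inv_diag_pos[of l n] pos[of l] pos[of j]
      by (intro mult_left_mono mult_right_mono) auto
    also have "\<dots> = G n l j / G n l l" using pos[of l] pos[of j] by simp
    finally show ?thesis .
  qed
  show ?thesis
  proof (rule tendsto_sandwich[OF _ _ lim tendsto_const])
    show "\<forall>\<^sub>F n in sequentially. ?F n \<le> G n l j / G n l l"
      unfolding eventually_sequentially using lower by (intro exI[of _ "max l j"]) simp
    show "\<forall>\<^sub>F n in sequentially. G n l j / G n l l \<le> p j / p l"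
      unfolding eventually_sequentially using upper by (intro exI[of _ "max l j"]) simp
  qed
qed

lemma normalized_excessive_tendsto:
  assumes p: "stationary_distribution q p"
    and B: "finite B" "j \<in> B"
    and ex: "\<And>n i. Max B \<le> n \<Longrightarrow> i \<le> n \<Longrightarrow> 0 \<le> (\<Sum>k\<le>n. z n k * - q k i)"
    and nonneg: "\<And>n i. Max B \<le> n \<Longrightarrow> i \<in> B \<Longrightarrow> 0 \<le> z n i"
    and norm: "\<And>n. Max B \<le> n \<Longrightarrow> (\<Sum>i\<in>B. z n i) = 1"
  shows "(\<lambda>n. z n j) \<longlonglongrightarrow> p j / (\<Sum>i\<in>B. p i)"
proof -
  have pos: "0 < p i" for i using p unfolding stationary_distribution_def by auto
  \<comment> \<open>The error of the row ratio against its limit, scaled by \<open>p l\<close>; it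
    controls the cross differences because the normalised entries lie between 0 and 1.\<close>
  define d where "d l i n = p i - p l * (G n l i / G n l l)" for l i n
  have d0: "d l i \<longlonglongrightarrow> 0" for l i
  proof -
    have "(\<lambda>n. p i - p l * (G n l i / G n l l)) \<longlonglongrightarrow> p i - p l * (p i / p l)"
      by (intro tendsto_intros nw_inv_row_ratio_tendsto p)
    then show ?thesis using pos[of l] by (simp add: d_def[abs_def])
  qed
  have cross: "z n l * p i - z n i * p l \<le> \<bar>d l i n\<bar>"
    if n: "Max B \<le> n" and li: "l \<in> B" "i \<in> B" for n l i
  proof -
    have le: "l \<le> n" "i \<le> n" using li n Max_ge[OF B(1)] by (auto intro: order_trans)
    have "z n l * G n l i \<le> z n i * G n l l"
      using ex n le by (intro excessive_lower_bound) auto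
    then have "z n l * (G n l i / G n l l) \<le> z n i"
      using nw_inv_diag_pos[OF le(1)] by (simp add: pos_divide_le_eq)
    then have "z n l * (G n l i / G n l l) * p l \<le> z n i * p l"
      using pos[of l] by (intro mult_right_mono) auto
    then have "z n l * p i - z n i * p l \<le> z n l * d l i n"
      by (simp add: d_def algebra_simps)
    also have "\<dots> \<le> z n l * \<bar>d l i n\<bar>"
      using nonneg n li by (intro mult_left_mono) auto
    also have "\<dots> \<le> 1 * \<bar>d l i n\<bar>"
    proof (rule mult_right_mono)
      have "z n l \<le> (\<Sum>i\<in>B. z n i)" using nonneg n li B by (intro member_le_sum) auto
      then show "z n l \<le> 1" using norm[OF n] by simp
    qed simp
    finally show ?thesis by simp
  qed
  have diff: "(\<lambda>n. z n j * p l - z n l * p j) \<longlonglongrightarrow> 0" if l: "l \<in> B" for l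
  proof (rule Lim_null_comparison)
    have "\<bar>z n j * p l - z n l * p j\<bar> \<le> \<bar>d j l n\<bar> + \<bar>d l j n\<bar>" if "Max B \<le> n" for n
      using cross[OF that l B(2)] cross[OF that B(2) l] by linarith
    then show "\<forall>\<^sub>F n in sequentially. norm (z n j * p l - z n l * p j) \<le> \<bar>d j l n\<bar> + \<bar>d l j n\<bar>"
      unfolding eventually_sequentially by (intro exI[of _ "Max B"]) simp
    have "(\<lambda>n. \<bar>d j l n\<bar> + \<bar>d l j n\<bar>) \<longlonglongrightarrow> \<bar>0\<bar> + \<bar>0\<bar>"
      by (intro tendsto_intros d0)
    then show "(\<lambda>n. \<bar>d j l n\<bar> + \<bar>d l j n\<bar>) \<longlonglongrightarrow> 0" by simp
  qed
  define S where "S = (\<Sum>i\<in>B. p i)"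
  have S: "0 < S" unfolding S_def using B pos by (intro sum_pos) auto
  \<comment> \<open>Summed over \<open>B\<close>, the cross differences equal
    \<open>z n j * S - p j\<close> by the normalisation, so their vanishing determines the limit of
    \<open>z n j\<close>.\<close>
  have "(\<lambda>n. (\<Sum>l\<in>B. z n j * p l - z n l * p j)) \<longlonglongrightarrow> (\<Sum>l\<in>B. 0)"
    by (intro tendsto_sum diff)
  then have "(\<lambda>n. (p j + (\<Sum>l\<in>B. z n j * p l - z n l * p j)) / S) \<longlonglongrightarrow> (p j + 0) / S"
    using S by (intro tendsto_intros) auto
  then have lim: "(\<lambda>n. (p j + (\<Sum>l\<in>B. z n j * p l - z n l * p j)) / S) \<longlonglongrightarrow> p j / S" by simp
  have "(p j + (\<Sum>l\<in>B. z n j * p l - z n l * p j)) / S = z n j" if "Max B \<le> n" for n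
  proof -
    have "(\<Sum>l\<in>B. z n j * p l - z n l * p j) = z n j * S - p j"
      using norm[OF that] by (simp add: sum_subtractf S_def flip: sum_distrib_left sum_distrib_right)
    then show ?thesis using S by simp
  qed
  then show ?thesis unfolding S_def[symmetric]
    by (intro Lim_transform_eventually[OF lim])
      (auto simp: eventually_sequentially intro!: exI[of _ "Max B"])
qed

end

lemma ergodic_generator_recurrent:
  assumes "ergodic_generator q"
  shows "recurrent_q_matrix q"
proof -
  obtain P where q: "conservative_q_matrix q" and P: "\<And>i. ctmc_law q i (P i)"
    "irreducible_chain P" "positive_recurrent_chain P"
    using assms unfolding ergodic_generator_def by blast
  show ?thesis
  proof unfold_locales
    show "conservative_q_matrix q" by (rule q)
    show "C = UNIV" if "C \<noteq> {}" "\<And>i j. i \<in> C \<Longrightarrow> i \<noteq> j \<Longrightarrow> 0 < q i j \<Longrightarrow> j \<in> C" for C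
      using irreducible_chain_closed_set[OF q P(1,2) that] .
    show "(\<lambda>k. surv q (- {i}) k i) \<longlonglongrightarrow> 0" for i
      by (rule positive_recurrent_chain_surv[OF q P(1,3)])
  qed
qed

section \<open>Rows of normalised truncated inverses\<close>

lemma normalize_row_index:
  assumes "dim_row v = 1" "k < dim_col v"
  shows "normalize_row v $$ (0, k) = v $$ (0, k) / (\<Sum>m<dim_col v. v $$ (0, m))"
  using assms
  by (auto simp: normalize_row_def ones_col_def scalar_prod_def divide_inverse mult.commute atLeast0LessThan)

lemma sum_sorted_list_of_set:
  assumes "finite (B :: nat set)"
  shows "(\<Sum>m<card B. f (sorted_list_of_set B ! m)) = sum f B"
proof -
  have "bij_betw ((!) (sorted_list_of_set B)) {..<card B} B"
    using assms by (intro bij_betw_nth) auto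
  then show ?thesis by (rule sum.reindex_bij_betw)
qed

lemma sorted_list_of_set_nth_mem:
  "finite (B :: nat set) \<Longrightarrow> k < card B \<Longrightarrow> sorted_list_of_set B ! k \<in> B"
  by (metis length_sorted_list_of_set nth_mem set_sorted_list_of_set)

theorem theorem2p3:
  fixes q :: "nat \<Rightarrow> nat \<Rightarrow> real"
    and p :: "nat \<Rightarrow> real"
    and B :: "nat set"
    and \<alpha> :: "nat \<Rightarrow> nat \<Rightarrow> real"
  assumes "ergodic_generator q"
    and "stationary_distribution q p"
    and "finite B" and "B \<noteq> {}"
    and "\<And>n. n \<ge> Max B \<Longrightarrow> prob_vector_upto n (\<alpha> n)"
    and "\<And>n. n \<ge> Max B \<Longrightarrow> 0 < (\<Sum>i\<in>reach_set q B n. \<alpha> n i)"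
  shows "\<forall>k<card B.
    (\<lambda>n. normalize_row (row_upto n (\<alpha> n) * nw_inv q n * col_selector n B) $$ (0, k))
      \<longlonglongrightarrow> normalize_row (row_on B p) $$ (0, k)"
proof (intro allI impI)
  fix k assume k: "k < card B"
  interpret recurrent_q_matrix q by (rule ergodic_generator_recurrent) fact
  let ?b = "\<lambda>m. sorted_list_of_set B ! m"
  define x where "x n j = (\<Sum>i\<le>n. \<alpha> n i * G n i j)" for n j
  define z where "z n j = x n j / (\<Sum>i\<in>B. x n i)" for n j
  have B: "l \<le> n" if "l \<in> B" "Max B \<le> n" for l n
    using that Max_ge[OF assms(3)] order_trans by blast
  have \<alpha>: "0 \<le> \<alpha> n i" if "Max B \<le> n" "i \<le> n" for n i
    using assms(5)[OF that(1)] that(2) unfolding prob_vector_upto_def by blast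
  have x_nonneg: "0 \<le> x n j" if "Max B \<le> n" "j \<le> n" for n j
    unfolding x_def using that \<alpha> nw_inv_nonneg by (intro sum_nonneg mult_nonneg_nonneg) auto
  have x_pos: "0 < (\<Sum>j\<in>B. x n j)" if n: "Max B \<le> n" for n
  proof -
    \<comment> \<open>The condition on \<open>\<alpha>\<close> yields a state with positive weight
      from which \<open>B\<close> is reached, so the normalising denominator is positive.\<close>
    have "\<exists>i\<in>reach_set q B n. 0 < \<alpha> n i"
      using assms(6)[OF n] sum_nonpos[of "reach_set q B n" "\<alpha> n"] by (meson not_le)
    then obtain i where i: "i \<le> n" "0 < (\<Sum>j\<in>B. G n i j)" "0 < \<alpha> n i"
      unfolding reach_set_def by blast
    have "0 < \<alpha> n i * (\<Sum>j\<in>B. G n i j)" using i by simp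
    also have "\<dots> \<le> (\<Sum>i\<le>n. \<alpha> n i * (\<Sum>j\<in>B. G n i j))"
      using i(1) n \<alpha> B nw_inv_nonneg
      by (intro member_le_sum mult_nonneg_nonneg sum_nonneg) auto
    also have "\<dots> = (\<Sum>j\<in>B. x n j)"
      unfolding x_def sum_distrib_left by (rule sum.swap)
    finally show ?thesis .
  qed
  have lim: "(\<lambda>n. z n (?b k)) \<longlonglongrightarrow> p (?b k) / (\<Sum>i\<in>B. p i)"
  proof (rule normalized_excessive_tendsto[OF assms(2,3)])
    show "?b k \<in> B" by (rule sorted_list_of_set_nth_mem[OF assms(3) k])
    fix n assume n: "Max B \<le> n"
    show "0 \<le> (\<Sum>m\<le>n. z n m * - q m i)" if "i \<le> n" for i
    proof -
      \<comment> \<open>Division by a positive constant preserves excessiveness.\<close>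
      have "(\<Sum>m\<le>n. z n m * - q m i) = (\<Sum>m\<le>n. x n m * - q m i) / (\<Sum>i\<in>B. x n i)"
        unfolding z_def sum_divide_distrib by simp
      moreover have "0 \<le> (\<Sum>m\<le>n. x n m * - q m i)"
        unfolding x_def using \<alpha>[OF n] that by (rule prob_row_excessive)
      ultimately show ?thesis using x_pos[OF n] by simp
    qed
    show "0 \<le> z n i" if "i \<in> B" for i
      unfolding z_def using x_nonneg[OF n B[OF that n]] x_pos[OF n] by simp
    show "(\<Sum>i\<in>B. z n i) = 1"
      unfolding z_def using x_pos[OF n] by (simp flip: sum_divide_distrib)
  qed
  have target: "normalize_row (row_on B p) $$ (0, k) = p (?b k) / (\<Sum>i\<in>B. p i)"
    using k by (subst normalize_row_index) (auto simp: row_on_def sum_sorted_list_of_set[OF assms(3)])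
  have entry: "z n (?b k) =
      normalize_row (row_upto n (\<alpha> n) * nw_inv q n * col_selector n B) $$ (0, k)"
    if n: "Max B \<le> n" for n
  proof -
    let ?v = "row_upto n (\<alpha> n) * nw_inv q n * col_selector n B"
    note inv = nw_inv_inverse(3)[of n]
    have row: "(row_upto n (\<alpha> n) * nw_inv q n) $$ (0, j) = x n j" if "j \<le> n" for j
      using that inv
      by (auto simp: row_upto_def scalar_prod_def x_def atLeast0AtMost atLeastLessThanSuc_atLeastAtMost
          simp del: sum.op_ivl_Suc)
    have v: "?v $$ (0, m) = x n (?b m)" if m: "m < card B" for m
    proof -
      have b: "?b m \<le> n" using B[OF sorted_list_of_set_nth_mem[OF assms(3) m] n] .
      have "?v $$ (0, m) = (\<Sum>j\<in>{0..<n + 1}. (row_upto n (\<alpha> n) * nw_inv q n) $$ (0, j) *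
          (if j = ?b m then 1 else 0))"
        using m inv
        by (subst index_mult_mat) (auto simp: row_upto_def col_selector_def scalar_prod_def
            intro!: sum.cong simp del: sum.op_ivl_Suc)
      \<comment> \<open>Column \<open>m\<close> of the selector picks out the state
        \<open>?b m\<close>, which lies within the truncation because \<open>n\<close> is at least
        \<open>Max B\<close>.\<close>
      also have "\<dots> = (\<Sum>j\<in>{0..<n + 1}. if j = ?b m then x n j else 0)"
        by (intro sum.cong refl) (auto simp: row)
      also have "\<dots> = x n (?b m)" using b by simp
      finally show ?thesis .
    qed
    have dim: "dim_row ?v = 1" "dim_col ?v = card B" by (simp_all add: row_upto_def col_selector_def)
    have "normalize_row ?v $$ (0, k) = x n (?b k) / (\<Sum>m<card B. x n (?b m))"
      using k v by (subst normalize_row_index) (simp_all only: dim, simp)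
    then show ?thesis by (simp add: z_def sum_sorted_list_of_set[OF assms(3)])
  qed
  show "(\<lambda>n. normalize_row (row_upto n (\<alpha> n) * nw_inv q n * col_selector n B) $$ (0, k))
      \<longlonglongrightarrow> normalize_row (row_on B p) $$ (0, k)"
    unfolding target
    by (rule Lim_transform_eventually[OF lim], rule eventually_sequentiallyI) (rule entry)
qed

end
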